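(* Let $G$ be a cycle with at least one whisker, and let $n$ be the number of vertices of $G$. Then $c_G(\mathfrak m)=2n-b(G)$.
   Context: Let $G$ be a finite simple graph on the vertex set $[n]=\{1,\dots,n\}$, let $K$ be a field, $S=K[x_1,\dots,x_n,y_1,\dots,y_n]$ and $\mathfrak m=(x_1,\dots,x_n,y_1,\dots,y_n)$. The binomial edge ideal of $G$ is $J_G=(x_iy_j-x_jy_i : \{i,j\}\in E(G))\subset S$. For a positive integer $k$ put $\mathfrak m^{[k]}=(x_1^k,\dots,x_n^k,y_1^k,\dots,y_n^k)$, $(\mathfrak m^{[k]},J_G)=\mathfrak m^{[k]}+J_G$, $v_G(k)=\max\{r\in\mathbb N : \mathfrak m^r\not\subseteq(\mathfrak m^{[k]},J_G)\}$, and $c_G(\mathfrak m)=\lim_{k\to\infty} v_G(k)/k$ (the diagonal $F$-threshold of $S/J_G$). A whisker of a graph is an edge $\{v,w\}$ one of whose endpoints has degree $1$. A cycle with whiskers is a graph obtained from a cycle (on at least $3$ vertices) by attaching whiskers to vertices of the cycle, i.e. adding new vertices each joined by an edge to exactly one vertex, which lies on the cycle. A clique matching of $G$ is a (possibly empty) set $Q$ of pairwise vertex-disjoint cliques of $G$, each having at least $2$ vertices; $V(Q)$ is the union of the vertex sets of its cliques. Set $b(G)=\max\{|V(Q)| : Q \text{ a clique matching of } G\}$. *)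

theory Defs
  imports Complex_Main "HOL-Library.Poly_Mapping" "HOL-Library.Set_Algebras"
    "HOL-Library.Disjoint_Sets" "HOL-Library.Ramsey" "HOL-Library.Cardinality"
begin

text \<open>The vertex set is the universe of a finite type \<open>'v\<close>, so \<open>n = CARD('v)\<close>. A graph is given by
  its edge set \<open>E :: 'v set set\<close>, and \<open>[A]\<^bsup>2\<^esup>\<close> denotes the set of two-element subsets of \<open>A\<close>.\<close>

definition simple_graph :: "'v set set \<Rightarrow> bool" where
  "simple_graph E \<longleftrightarrow> E \<subseteq> [UNIV]\<^bsup>2\<^esup>"

definition degree :: "'v set set \<Rightarrow> 'v \<Rightarrow> nat" where
  "degree E v = card {e \<in> E. v \<in> e}"

definition whisker :: "'v set set \<Rightarrow> 'v set \<Rightarrow> bool" where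
  "whisker E e \<longleftrightarrow> e \<in> E \<and> (\<exists>v\<in>e. degree E v = 1)"

definition cycle_edges :: "'v list \<Rightarrow> 'v set set" where
  "cycle_edges c = {{c ! i, c ! (Suc i mod length c)} | i. i < length c}"

text \<open>The cycle runs through the list \<open>c\<close>; the map \<open>f\<close> sends each remaining vertex to the cycle
  vertex at which it is attached.\<close>

definition cycle_with_whiskers :: "'v set set \<Rightarrow> bool" where
  "cycle_with_whiskers E \<longleftrightarrow>
     (\<exists>c f. distinct c \<and> 3 \<le> length c \<and> (\<forall>w. w \<notin> set c \<longrightarrow> f w \<in> set c) \<and>
            E = cycle_edges c \<union> {{w, f w} | w. w \<notin> set c})"

definition clique :: "'v set set \<Rightarrow> 'v set \<Rightarrow> bool" where
  "clique E C \<longleftrightarrow> [C]\<^bsup>2\<^esup> \<subseteq> E"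

definition clique_matching :: "'v set set \<Rightarrow> 'v set set \<Rightarrow> bool" where
  "clique_matching E Q \<longleftrightarrow> (\<forall>C\<in>Q. clique E C \<and> 2 \<le> card C) \<and> disjoint Q"

definition b_graph :: "'v set set \<Rightarrow> nat" where
  "b_graph E = Max {card (\<Union>Q) | Q. clique_matching E Q}"

text \<open>\<open>S = K[x\<^sub>v, y\<^sub>v : v]\<close>, as finitely supported maps from monomials (exponent vectors) to
  coefficients, with the convolution product.\<close>

datatype 'v xy = X 'v | Y 'v

type_synonym ('v, 'k) S = "('v xy \<Rightarrow>\<^sub>0 nat) \<Rightarrow>\<^sub>0 'k"

definition var :: "'v xy \<Rightarrow> ('v, 'k::field) S" where
  "var z = Poly_Mapping.single (Poly_Mapping.single z 1) 1"

abbreviation x_var :: "'v \<Rightarrow> ('v, 'k::field) S" where "x_var v \<equiv> var (X v)"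
abbreviation y_var :: "'v \<Rightarrow> ('v, 'k::field) S" where "y_var v \<equiv> var (Y v)"

definition ideal_gen :: "'a::comm_ring_1 set \<Rightarrow> 'a set" where
  "ideal_gen B = module.span (*) B"

primrec ideal_power :: "'a::comm_ring_1 set \<Rightarrow> nat \<Rightarrow> 'a set" where
  "ideal_power I 0 = UNIV"
| "ideal_power I (Suc r) = ideal_gen {a * b | a b. a \<in> I \<and> b \<in> ideal_power I r}"

definition max_ideal :: "('v, 'k::field) S set" where
  "max_ideal = ideal_gen (range var)"

definition max_ideal_frob :: "nat \<Rightarrow> ('v, 'k::field) S set" where
  "max_ideal_frob k = ideal_gen {var z ^ k | z. True}"

definition binomial_edge_ideal :: "'v set set \<Rightarrow> ('v, 'k::field) S set" where
  "binomial_edge_ideal E = ideal_gen {x_var i * y_var j - x_var j * y_var i | i j. {i, j} \<in> E}"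

text \<open>Only positive \<open>k\<close> matter: for \<open>k = 0\<close> the set below is empty and the value of \<open>Max\<close> is
  unspecified. The argument of type \<open>'k itself\<close> names the field, and \<open>+\<close> is the
  elementwise sum of sets.\<close>

definition v_graph :: "'k::field itself \<Rightarrow> 'v set set \<Rightarrow> nat \<Rightarrow> nat" where
  "v_graph _ E k = Max {r. \<not> ideal_power (max_ideal :: ('v, 'k) S set) r
                            \<subseteq> max_ideal_frob k + binomial_edge_ideal E}"

definition diagonal_F_threshold :: "'k::field itself \<Rightarrow> 'v set set \<Rightarrow> real" where
  "diagonal_F_threshold K E = lim (\<lambda>k. real (v_graph K E k) / real k)"

end

theory Submission
  imports Defs
begin

text \<open>A cycle with a whisker has a vertex cover \<open>T\<close> together with an injection of \<open>T\<close> into its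
  complement along edges (as in Koenig's theorem). So \<open>b(G) = 2|T|\<close>, and in fact
  \<open>v\<^sub>G(k) = (k - 1)(2n - 2|T|)\<close> for every \<open>k \<ge> 1\<close>. For the lower bound, no term
  \<open>x\<^sub>i y\<^sub>j\<close> with \<open>{i,j}\<close> an edge divides the product of all \<open>(x\<^sub>i y\<^sub>i)\<^bsup>k-1\<^esup>\<close> with \<open>i \<notin> T\<close>, so this
  monomial avoids even the monomial ideal generated by these terms and the \<open>k\<close>-th powers of the
  variables. For the upper bound, a monomial of larger degree has degree at least \<open>2k - 1\<close> in the
  variables of one unmatched vertex or of one matching edge \<open>{a,b}\<close>; in the second case the
  relation \<open>x\<^sub>a y\<^sub>b = x\<^sub>b y\<^sub>a\<close> moves exponents until one of them reaches \<open>k\<close>.\<close>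

section \<open>Ideals and monomials\<close>

interpretation ring_module: module "(*) :: 'a::comm_ring_1 \<Rightarrow> 'a \<Rightarrow> 'a"
  by standard (simp_all add: algebra_simps)

abbreviation lookup :: "('a \<Rightarrow>\<^sub>0 'b::zero) \<Rightarrow> 'a \<Rightarrow> 'b" where
  "lookup \<equiv> Poly_Mapping.lookup"

abbreviation keys :: "('a \<Rightarrow>\<^sub>0 'b::zero) \<Rightarrow> 'a set" where
  "keys \<equiv> Poly_Mapping.keys"

abbreviation single :: "'a \<Rightarrow> 'b \<Rightarrow> ('a \<Rightarrow>\<^sub>0 'b::zero)" where
  "single \<equiv> Poly_Mapping.single"

abbreviation mon :: "('v xy \<Rightarrow>\<^sub>0 nat) \<Rightarrow> ('v, 'k::field) S" where
  "mon s \<equiv> single s 1"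

text \<open>As \<open>P\<close> passes to multiples, the polynomials whose monomials all satisfy
  \<open>P\<close> form an ideal. It serves for lower bounds on the degree and for not dividing a
  fixed monomial.\<close>

lemma keys_ideal_gen:
  fixes B :: "('v, 'k::field) S set"
  assumes f: "f \<in> ideal_gen B"
    and up: "\<And>s t. P s \<Longrightarrow> P (t + s)"
    and B: "\<And>b s. b \<in> B \<Longrightarrow> s \<in> keys b \<Longrightarrow> P s"
  shows "\<forall>s\<in>keys f. P s"
  using f unfolding ideal_gen_def
proof (induction rule: ring_module.span_induct)
  case base
  show ?case
    unfolding ring_module.subspace_def
  proof (intro conjI ballI allI; clarsimp)
    fix p q :: "('v, 'k) S" and s
    assume "\<forall>s\<in>keys p. P s" "\<forall>s\<in>keys q. P s" "s \<in> keys (p + q)"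
    then show "P s" using keys_add[of p q] by blast
  next
    fix c p :: "('v, 'k) S" and s
    assume "\<forall>s\<in>keys p. P s" "s \<in> keys (c * p)"
    then show "P s" using keys_mult[of c p] up by blast
  qed
next
  case (step b)
  then show ?case using B by blast
qed

lemma sum_ideal_gen: "ideal_gen A + ideal_gen B = ideal_gen (A \<union> B)"
  unfolding ideal_gen_def ring_module.span_Un set_plus_def by auto

lemma ideal_gen_mult: "f \<in> ideal_gen B \<Longrightarrow> g * f \<in> ideal_gen B"
  unfolding ideal_gen_def by (rule ring_module.span_scale)

lemma monomials_in_ideal_gen:
  fixes f :: "('v, 'k::field) S"
  assumes "\<And>s. s \<in> keys f \<Longrightarrow> mon s \<in> ideal_gen B"
  shows "f \<in> ideal_gen B"
proof -
  have "single s (lookup f s) \<in> ideal_gen B" if "s \<in> keys f" for s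
    using ideal_gen_mult[OF assms[OF that], of "single 0 (lookup f s)"]
    by (simp add: mult_single)
  then have "(\<Sum>s\<in>keys f. single s (lookup f s)) \<in> ideal_gen B"
    unfolding ideal_gen_def by (rule ring_module.span_sum)
  also have "(\<Sum>s\<in>keys f. single s (lookup f s)) = f"
    by (rule poly_mapping_eqI)
      (simp add: lookup_sum lookup_single when_def sum.If_cases in_keys_iff)
  finally show ?thesis .
qed

lemma var_power: "var z ^ k = mon (single z k)"
  by (induction k) (simp_all add: var_def mult_single single_add[symmetric] add.commute)

lemma var_mult: "var a * var b = mon (single a 1 + single b 1)"
  by (simp add: var_def mult_single)

lemma single_le_imp_sum:
  assumes "k \<le> lookup s z"
  obtains t :: "'a \<Rightarrow>\<^sub>0 nat" where "s = t + single z k"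
proof
  show "s = (s - single z k) + single z k"
    by (rule poly_mapping_eqI)
      (use assms in \<open>auto simp: lookup_add lookup_minus lookup_single when_def\<close>)
qed

section \<open>Degrees of monomials\<close>

definition deg_at :: "('v xy \<Rightarrow>\<^sub>0 nat) \<Rightarrow> 'v \<Rightarrow> nat" where
  "deg_at s v = lookup s (X v) + lookup s (Y v)"

definition deg :: "('v::finite xy \<Rightarrow>\<^sub>0 nat) \<Rightarrow> nat" where
  "deg s = (\<Sum>v\<in>UNIV. deg_at s v)"

lemma deg_add: "deg (s + t) = deg s + deg t"
  by (simp add: deg_def deg_at_def lookup_add sum.distrib)

lemma deg_single: "deg (single z k) = k"
proof (cases z)
  case (X v)
  have "deg_at (single z k) w = (if w = v then k else 0)" for w
    by (simp add: X deg_at_def lookup_single when_def)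
  then show ?thesis by (simp add: deg_def)
next
  case (Y v)
  have "deg_at (single z k) w = (if w = v then k else 0)" for w
    by (simp add: Y deg_at_def lookup_single when_def)
  then show ?thesis by (simp add: deg_def)
qed

lemma deg_ge_1_of_max_ideal:
  fixes f :: "('v::finite, 'k::field) S"
  assumes "f \<in> max_ideal"
  shows "\<forall>s\<in>keys f. 1 \<le> deg s"
  using assms unfolding max_ideal_def
  by (rule keys_ideal_gen) (auto simp: deg_add var_def deg_single)

lemma deg_ge_of_ideal_power:
  fixes f :: "('v::finite, 'k::field) S"
  assumes "f \<in> ideal_power max_ideal r"
  shows "\<forall>s\<in>keys f. r \<le> deg s"
  using assms
proof (induction r arbitrary: f)
  case (Suc r)
  show ?case
  proof (rule keys_ideal_gen)
    show "f \<in> ideal_gen {a * b | a b. a \<in> max_ideal \<and> b \<in> ideal_power max_ideal r}"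
      using Suc.prems by simp
    fix b :: "('v, 'k) S" and s
    assume "b \<in> {a * b | a b. a \<in> max_ideal \<and> b \<in> ideal_power max_ideal r}"
      and s: "s \<in> keys b"
    then obtain p q where pq: "b = p * q" "p \<in> max_ideal" "q \<in> ideal_power max_ideal r"
      by blast
    with s keys_mult[of p q] obtain s1 s2 where "s = s1 + s2" "s1 \<in> keys p" "s2 \<in> keys q"
      by blast
    with pq Suc.IH deg_ge_1_of_max_ideal show "Suc r \<le> deg s"
      by (fastforce simp: deg_add)
  qed (simp add: deg_add)
qed simp

text \<open>One variable is split off at a time. A monomial outside an ideal thus witnesses that the
  ideal does not contain the power of \<open>max_ideal\<close> given by its degree.\<close>

lemma mon_in_ideal_power: "mon s \<in> ideal_power (max_ideal :: ('v::finite, 'k::field) S set) (deg s)"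
proof (induction "deg s" arbitrary: s)
  case 0
  then show ?case by (metis UNIV_I ideal_power.simps(1))
next
  case (Suc r)
  then have "(\<Sum>v\<in>UNIV. deg_at s v) \<noteq> 0" unfolding deg_def by linarith
  then obtain v where "deg_at s v \<noteq> 0" using sum.not_neutral_contains_not_neutral by blast
  then have "1 \<le> lookup s (X v) \<or> 1 \<le> lookup s (Y v)"
    unfolding deg_at_def by linarith
  then obtain z where "1 \<le> lookup s z" by blast
  then obtain t where t: "s = t + single z 1" by (rule single_le_imp_sum)
  with Suc.hyps(2) have r: "r = deg t" by (simp add: deg_add deg_single)
  have "var z \<in> (max_ideal :: ('v, 'k) S set)"
    unfolding max_ideal_def ideal_gen_def by (rule ring_module.span_base) simp
  moreover have "mon t \<in> ideal_power (max_ideal :: ('v, 'k) S set) r"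
    using Suc.hyps(1)[OF r] r by simp
  moreover have "mon s = var z * (mon t :: ('v, 'k) S)"
    by (simp add: t var_def mult_single add.commute)
  ultimately have "(mon s :: ('v, 'k) S) \<in> ideal_power max_ideal (Suc r)"
    unfolding ideal_power.simps ideal_gen_def
    by (intro ring_module.span_base) blast
  then show ?case using Suc.hyps(2) by simp
qed

section \<open>The ideal and the two bounds\<close>

definition frob_edge_ideal :: "'v set set \<Rightarrow> nat \<Rightarrow> ('v, 'k::field) S set" where
  "frob_edge_ideal E k = ideal_gen ({var z ^ k | z. True} \<union>
     {x_var i * y_var j - x_var j * y_var i | i j. {i, j} \<in> E})"

lemma frob_edge_ideal: "max_ideal_frob k + binomial_edge_ideal E = frob_edge_ideal E k"
  unfolding max_ideal_frob_def binomial_edge_ideal_def frob_edge_ideal_def sum_ideal_gen ..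

section \<open>Upper bound: monomials of large degree\<close>

lemma power_in_frob_edge_ideal:
  assumes "k \<le> lookup s z"
  shows "(mon s :: ('v, 'k::field) S) \<in> frob_edge_ideal E k"
proof -
  obtain t where "s = t + single z k" using assms by (rule single_le_imp_sum)
  then have "mon s = mon t * (var z ^ k :: ('v, 'k) S)" by (simp add: var_power mult_single)
  moreover have "(var z ^ k :: ('v, 'k) S) \<in> frob_edge_ideal E k"
    unfolding frob_edge_ideal_def ideal_gen_def by (rule ring_module.span_base) blast
  ultimately show ?thesis unfolding frob_edge_ideal_def by (simp only: ideal_gen_mult)
qed

lemma edge_relation_in_frob_edge_ideal:
  assumes "{i, j} \<in> E"
  shows "x_var i * y_var j - x_var j * y_var i \<in> frob_edge_ideal E k"
  unfolding frob_edge_ideal_def ideal_gen_def by (rule ring_module.span_base) (use assms in blast)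

text \<open>Modulo the ideal, one \<open>b\<close> and one \<open>c\<close> may be traded for one
  \<open>a\<close> and one \<open>d\<close>. A trade raises the exponent of \<open>a\<close> and
  lowers neither of the two sums. While the exponent of \<open>a\<close> is below \<open>k\<close>,
  these sums keep \<open>b\<close> and \<open>c\<close> available, so trading continues until the
  \<open>k\<close>-th power of \<open>a\<close> divides.\<close>

lemma exchange:
  assumes rel: "var b * var c - var a * var d \<in> (frob_edge_ideal E k :: ('v, 'k::field) S set)"
    and dist: "a \<noteq> b" "a \<noteq> c" "b \<noteq> c" "b \<noteq> d" "c \<noteq> d"
    and "k \<le> lookup s a + lookup s b" "k \<le> lookup s a + lookup s c"
  shows "(mon s :: ('v, 'k) S) \<in> frob_edge_ideal E k"
  using assms(7,8)
proof (induction "k - lookup s a" arbitrary: s rule: less_induct)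
  case less
  show ?case
  proof (cases "k \<le> lookup s a")
    case True
    then show ?thesis by (rule power_in_frob_edge_ideal)
  next
    case False
    with less.prems have pos: "1 \<le> lookup s b" "1 \<le> lookup s c" by auto
    from pos(1) obtain t1 where t1: "s = t1 + single b 1"
      by (rule single_le_imp_sum)
    with pos(2) dist have "1 \<le> lookup t1 c" by (simp add: lookup_add lookup_single)
    then obtain t where "t1 = t + single c 1" by (rule single_le_imp_sum)
    with t1 have t: "s = t + (single b 1 + single c 1)"
      by (simp add: add_ac)
    let ?s = "t + (single a 1 + single d 1)"
    have "(mon ?s :: ('v, 'k) S) \<in> frob_edge_ideal E k"
      by (rule less.hyps) (use dist False less.prems in
          \<open>auto simp: t lookup_add lookup_single when_def\<close>)
    moreover have "mon t * (var b * var c - var a * var d) \<in> (frob_edge_ideal E k :: ('v, 'k) S set)"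
      using rel unfolding frob_edge_ideal_def by (rule ideal_gen_mult)
    moreover have "(mon s :: ('v, 'k) S) = mon t * (var b * var c - var a * var d) + mon ?s"
      by (simp add: t right_diff_distrib var_mult mult_single)
    ultimately show ?thesis
      unfolding frob_edge_ideal_def ideal_gen_def by (simp only: ring_module.span_add)
  qed
qed

text \<open>Arrange the four exponents in a square with rows \<open>X\<close>, \<open>Y\<close> and
  columns \<open>i\<close>, \<open>j\<close>. A total of at least \<open>2 * k - 1\<close> forces
  one row and one column to have sum at least \<open>k\<close>; their common entry becomes
  \<open>a\<close> in \<open>exchange\<close>.\<close>

lemma edge_in_frob_edge_ideal:
  assumes e: "{i, j} \<in> E" "i \<noteq> j" and d: "2 * k \<le> deg_at s i + deg_at s j + 1"
  shows "(mon s :: ('v, 'k::field) S) \<in> frob_edge_ideal E k"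
proof -
  let ?I = "frob_edge_ideal E k :: ('v, 'k) S set"
  have 1: "x_var i * y_var j - x_var j * y_var i \<in> ?I"
    using e(1) by (rule edge_relation_in_frob_edge_ideal)
  have 2: "x_var j * y_var i - x_var i * y_var j \<in> ?I"
    using e(1) by (intro edge_relation_in_frob_edge_ideal) (simp add: insert_commute)
  have "k \<le> lookup s (X i) + lookup s (X j) \<or> k \<le> lookup s (Y i) + lookup s (Y j)"
    "k \<le> lookup s (X i) + lookup s (Y i) \<or> k \<le> lookup s (X j) + lookup s (Y j)"
    using d by (auto simp: deg_at_def)
  then consider
      "k \<le> lookup s (X i) + lookup s (X j)" "k \<le> lookup s (X i) + lookup s (Y i)"
    | "k \<le> lookup s (X j) + lookup s (X i)" "k \<le> lookup s (X j) + lookup s (Y j)"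
    | "k \<le> lookup s (Y i) + lookup s (Y j)" "k \<le> lookup s (Y i) + lookup s (X i)"
    | "k \<le> lookup s (Y j) + lookup s (Y i)" "k \<le> lookup s (Y j) + lookup s (X j)"
    by (auto simp: add.commute)
  then show ?thesis
  proof cases
    case 1
    \<comment> \<open>The instantiation lists \<open>b\<close>, \<open>c\<close>, \<open>a\<close>,
      \<open>d\<close> in this order, so the third variable is the one whose exponent grows.\<close>
    then show ?thesis using 2 e by (intro exchange[of "X j" "Y i" "X i" "Y j"]) auto
  next
    case 2
    then show ?thesis using 1 e by (intro exchange[of "X i" "Y j" "X j" "Y i"]) auto
  next
    case 3
    then show ?thesis using 1 e
      by (intro exchange[of "Y j" "X i" "Y i" "X j"]) (auto simp: mult.commute)
  next
    case 4
    then show ?thesis using 2 e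
      by (intro exchange[of "Y i" "X j" "Y j" "X i"]) (auto simp: mult.commute)
  qed
qed

text \<open>The covering condition yields the lower bound on \<open>v_graph\<close> and the upper
  bound on \<open>b_graph\<close>; the matching along \<phi> yields the two opposite bounds.\<close>

definition koenig :: "'v set set \<Rightarrow> 'v set \<Rightarrow> ('v \<Rightarrow> 'v) \<Rightarrow> bool" where
  "koenig E T \<phi> \<longleftrightarrow> (\<forall>e\<in>E. e \<inter> T \<noteq> {}) \<and> inj_on \<phi> T \<and>
     (\<forall>t\<in>T. \<phi> t \<notin> T \<and> {t, \<phi> t} \<in> E)"

text \<open>The pairs \<open>{t, \<phi> t}\<close> and the unmatched single vertices form
  \<open>card (- T)\<close> blocks, each with exactly one vertex outside \<open>T\<close>. For a
  monomial outside the ideal, every block has degree at most \<open>2 * (k - 1)\<close>.\<close>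

lemma mon_in_frob_edge_ideal:
  fixes E :: "'v::finite set set"
  assumes K: "koenig E T \<phi>" and d: "(k - 1) * (2 * card (- T)) < deg s"
  shows "(mon s :: ('v, 'k::field) S) \<in> frob_edge_ideal E k"
proof (rule ccontr)
  assume notin: "\<not> ?thesis"
  have vertex: "deg_at s v \<le> 2 * (k - 1)" for v
  proof (rule ccontr)
    assume "\<not> ?thesis"
    then have "k \<le> lookup s (X v) \<or> k \<le> lookup s (Y v)" unfolding deg_at_def by linarith
    with notin show False using power_in_frob_edge_ideal by blast
  qed
  have edge: "deg_at s t + deg_at s (\<phi> t) \<le> 2 * (k - 1)" if "t \<in> T" for t
  proof (rule ccontr)
    assume "\<not> ?thesis"
    then have "2 * k \<le> deg_at s t + deg_at s (\<phi> t) + 1" by linarith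
    moreover have "{t, \<phi> t} \<in> E" "t \<noteq> \<phi> t" using K that unfolding koenig_def by auto
    ultimately show False using notin edge_in_frob_edge_ideal[of t "\<phi> t" E k s] by blast
  qed
  have inj: "inj_on \<phi> T" and sub: "\<phi> ` T \<subseteq> - T" using K unfolding koenig_def by auto
  have "deg s = sum (deg_at s) T + sum (deg_at s) (- T)"
    unfolding deg_def using sum.union_disjoint[of T "- T" "deg_at s"] by simp
  also have "sum (deg_at s) (- T) = sum (deg_at s) (\<phi> ` T) + sum (deg_at s) (- T - \<phi> ` T)"
    using sum.subset_diff[OF sub, of "deg_at s"] by simp
  also have "sum (deg_at s) (\<phi> ` T) = (\<Sum>t\<in>T. deg_at s (\<phi> t))"
    using inj by (simp add: sum.reindex)
  finally have "deg s = (\<Sum>t\<in>T. deg_at s t + deg_at s (\<phi> t)) + sum (deg_at s) (- T - \<phi> ` T)"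
    by (simp add: sum.distrib)
  also have "\<dots> \<le> card T * (2 * (k - 1)) + card (- T - \<phi> ` T) * (2 * (k - 1))"
    using sum_bounded_above[of T "\<lambda>t. deg_at s t + deg_at s (\<phi> t)" "2 * (k - 1)"] edge
      sum_bounded_above[of "- T - \<phi> ` T" "deg_at s" "2 * (k - 1)"] vertex
    by (intro add_mono) simp_all
  also have "card T = card (\<phi> ` T)" using inj by (simp add: card_image)
  also have "card (\<phi> ` T) * (2 * (k - 1)) + card (- T - \<phi> ` T) * (2 * (k - 1)) =
      (k - 1) * (2 * card (- T))"
    using card_Diff_subset[OF _ sub] card_mono[OF _ sub]
    by (simp add: add_mult_distrib[symmetric])
  finally show False using d by simp
qed

section \<open>Lower bound: a monomial outside the ideal\<close>

lemma cover_monomial_notin: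
  fixes E :: "'v::finite set set"
  assumes cover: "\<forall>e\<in>E. e \<inter> T \<noteq> {}" and k: "0 < k"
  obtains u where "deg u = (k - 1) * (2 * card (- T))"
    and "(mon u :: ('v, 'k::field) S) \<notin> frob_edge_ideal E k"
proof
  define g :: "'v xy \<Rightarrow> nat" where "g z = (case z of X v \<Rightarrow> if v \<in> T then 0 else k - 1
    | Y v \<Rightarrow> if v \<in> T then 0 else k - 1)" for z
  define u where "u = Abs_poly_mapping g"
  have "(UNIV :: 'v xy set) = range X \<union> range Y"
    by (metis UNIV_eq_I UnCI rangeI xy.exhaust)
  then have "finite (UNIV :: 'v xy set)"
    by (metis finite_Un finite_imageI finite)
  then have u: "lookup u = g"
    unfolding u_def by (intro lookup_Abs_poly_mapping) (metis finite_subset subset_UNIV)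
  have "deg_at u v = (if v \<in> - T then 2 * (k - 1) else 0)" for v
    by (simp add: deg_at_def u g_def)
  then show "deg u = (k - 1) * (2 * card (- T))"
    by (simp add: deg_def sum.If_cases Collect_neg_eq)
  show "(mon u :: ('v, 'k) S) \<notin> frob_edge_ideal E k"
  proof
    assume "(mon u :: ('v, 'k) S) \<in> frob_edge_ideal E k"
    \<comment> \<open>Multiples of a non-divisor of \<open>u\<close> are non-divisors, so it
      suffices that no monomial of a generator divides \<open>u\<close>. The contradiction is that
      \<open>u\<close> divides itself.\<close>
    then have "\<forall>s\<in>keys (mon u :: ('v, 'k) S). \<not> (\<exists>t. t + s = u)"
      unfolding frob_edge_ideal_def
    proof (rule keys_ideal_gen)
      fix b :: "('v, 'k) S" and s
      assume b: "b \<in> {var z ^ k | z. True} \<union>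
          {x_var i * y_var j - x_var j * y_var i | i j. {i, j} \<in> E}" and s: "s \<in> keys b"
      from b consider (pow) z where "b = var z ^ k"
        | (edge) i j where "{i, j} \<in> E" "b = x_var i * y_var j - x_var j * y_var i"
        by blast
      then show "\<not> (\<exists>t. t + s = u)"
      proof cases
        case pow
        with s have "lookup s z = k" by (simp add: var_power)
        moreover have "g z < k" using k by (simp add: g_def split: xy.split)
        ultimately show ?thesis by (auto simp: u[symmetric] lookup_add)
      next
        case edge
        from edge(2) s have "s = single (X i) 1 + single (Y j) 1 \<or>
            s = single (X j) 1 + single (Y i) 1"
          using keys_diff[of "x_var i * y_var j :: ('v, 'k) S" "x_var j * y_var i"]
          by (auto simp: var_mult)
        \<comment> \<open>Either term of the relation has a variable at each endpoint, while
          \<open>u\<close> has degree 0 at an endpoint in the cover.\<close>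
        then have "lookup s (X i) + lookup s (Y i) \<noteq> 0"
            "lookup s (X j) + lookup s (Y j) \<noteq> 0"
          by (auto simp: lookup_add lookup_single)
        moreover have "i \<in> T \<or> j \<in> T" using bspec[OF cover edge(1)] by auto
        then have "lookup u (X i) + lookup u (Y i) = 0 \<or>
            lookup u (X j) + lookup u (Y j) = 0"
          by (auto simp: u g_def)
        ultimately show ?thesis by (auto simp: lookup_add)
      qed
    next
      fix s t
      assume "\<not> (\<exists>t. t + s = u)"
      then show "\<not> (\<exists>t'. t' + (t + s) = u)" by (metis add.assoc)
    qed
    then show False by simp
  qed
qed

text \<open>Above this value every monomial of the power lies in the ideal; at this value the cover
  monomial does not. The first fact also makes the set under \<open>Max\<close> finite.\<close>

lemma v_graph_koenig:
  fixes E :: "'v::finite set set"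
  assumes K: "koenig E T \<phi>" and k: "0 < k"
  shows "v_graph TYPE('k::field) E k = (k - 1) * (2 * card (- T))"
proof -
  let ?N = "(k - 1) * (2 * card (- T))"
  let ?A = "{r. \<not> ideal_power (max_ideal :: ('v, 'k) S set) r \<subseteq> frob_edge_ideal E k}"
  have le: "r \<le> ?N" if "r \<in> ?A" for r
  proof (rule ccontr)
    assume "\<not> r \<le> ?N"
    then have "?N < r" by simp
    have mon: "(mon s :: ('v, 'k) S) \<in> frob_edge_ideal E k" if "r \<le> deg s" for s
      by (rule mon_in_frob_edge_ideal[OF K, of k]) (use that \<open>?N < r\<close> in linarith)
    have "ideal_power (max_ideal :: ('v, 'k) S set) r \<subseteq> frob_edge_ideal E k"
    proof
      fix f :: "('v, 'k) S"
      assume f: "f \<in> ideal_power max_ideal r"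
      show "f \<in> frob_edge_ideal E k"
        unfolding frob_edge_ideal_def
      proof (rule monomials_in_ideal_gen, fold frob_edge_ideal_def)
        fix s
        assume "s \<in> keys f"
        with deg_ge_of_ideal_power[OF f] have "r \<le> deg s" by simp
        then show "(mon s :: ('v, 'k) S) \<in> frob_edge_ideal E k" by (rule mon)
      qed
    qed
    with \<open>r \<in> ?A\<close> show False by simp
  qed
  have "\<forall>e\<in>E. e \<inter> T \<noteq> {}" using K unfolding koenig_def by simp
  then obtain u where u: "deg u = ?N" "(mon u :: ('v, 'k) S) \<notin> frob_edge_ideal E k"
    using k by (rule cover_monomial_notin)
  have "?N \<in> ?A" using mon_in_ideal_power[of u, where 'k = 'k] u by auto
  moreover have "finite ?A" using le by (meson finite_nat_set_iff_bounded_le)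
  ultimately show ?thesis
    unfolding v_graph_def frob_edge_ideal using le by (intro Max_eqI) auto
qed

section \<open>Clique matchings and the cycle\<close>

text \<open>Two vertices of a clique outside \<open>T\<close> would span an uncovered edge, so a
  clique has at most one vertex outside \<open>T\<close> and, having at least two vertices, at least
  half of them in \<open>T\<close>. Disjointness allows summing over the cliques, and the matching
  edges attain the bound.\<close>

lemma b_graph_koenig:
  fixes E :: "'v::finite set set"
  assumes K: "koenig E T \<phi>"
  shows "b_graph E = 2 * card T"
proof -
  let ?A = "{card (\<Union>Q) | Q. clique_matching E Q}"
  have le: "card (\<Union>Q) \<le> 2 * card T" if Q: "clique_matching E Q" for Q
  proof -
    have dis: "pairwise disjnt Q"
      using Q unfolding clique_matching_def disjoint_def pairwise_def disjnt_def by blast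
    have clique_le: "card C \<le> 2 * card (C \<inter> T)" if C: "C \<in> Q" for C
    proof -
      have "a = b" if "a \<in> C - T" "b \<in> C - T" for a b
      proof (rule ccontr)
        assume "a \<noteq> b"
        then have "{a, b} \<in> [C]\<^bsup>2\<^esup>" using that by (simp add: nsets_def)
        then have "{a, b} \<in> E" using Q C unfolding clique_matching_def clique_def by blast
        then have "{a, b} \<inter> T \<noteq> {}" using K unfolding koenig_def by blast
        then show False using that by simp
      qed
      then have "card (C - T) \<le> 1" by (simp add: card_le_Suc0_iff_eq)
      moreover have "card C = card (C \<inter> T) + card (C - T)"
        by (metis card_Int_Diff finite)
      moreover have "2 \<le> card C" using Q C unfolding clique_matching_def by blast
      ultimately show ?thesis by linarith
    qed
    have "card (\<Union>Q) = sum card Q" by (rule card_Union_disjoint) (use dis in auto)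
    also have "\<dots> \<le> (\<Sum>C\<in>Q. 2 * card (C \<inter> T))" by (rule sum_mono) (rule clique_le)
    also have "\<dots> = 2 * (\<Sum>C\<in>Q. card (C \<inter> T))" by (simp add: sum_distrib_left)
    also have "(\<Sum>C\<in>Q. card (C \<inter> T)) = card (\<Union>C\<in>Q. C \<inter> T)"
      using dis by (intro card_UN_disjoint[symmetric])
        (auto simp: pairwise_def disjnt_def)
    also have "\<dots> \<le> card T" by (rule card_mono) auto
    finally show ?thesis by simp
  qed
  have inj: "inj_on \<phi> T" and out: "\<And>t. t \<in> T \<Longrightarrow> \<phi> t \<notin> T" and E: "\<And>t. t \<in> T \<Longrightarrow> {t, \<phi> t} \<in> E"
    using K unfolding koenig_def by auto
  let ?Q = "(\<lambda>t. {t, \<phi> t}) ` T"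
  have "clique_matching E ?Q"
    unfolding clique_matching_def
  proof (intro conjI ballI)
    fix C assume "C \<in> ?Q"
    then obtain t where t: "t \<in> T" "C = {t, \<phi> t}" by blast
    with out have "card C = 2" by (metis card_2_iff)
    moreover have "e = C" if "e \<in> [C]\<^bsup>2\<^esup>" for e
      using that \<open>card C = 2\<close> by (auto simp: nsets_def card_subset_eq)
    ultimately show "clique E C" "2 \<le> card C"
      using t E unfolding clique_def by auto
  next
    show "disjoint ?Q"
      unfolding disjoint_def pairwise_def disjnt_def using out inj_onD[OF inj] by fastforce
  qed
  moreover have "card (\<Union>?Q) = 2 * card T"
  proof -
    have "\<Union>?Q = T \<union> \<phi> ` T" by auto
    moreover have "T \<inter> \<phi> ` T = {}" using out by auto
    ultimately show ?thesis using inj by (simp add: card_Un_disjoint card_image)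
  qed
  ultimately have "2 * card T \<in> ?A" by (metis (mono_tags, lifting) mem_Collect_eq)
  then show ?thesis unfolding b_graph_def
    by (intro Max_eqI) (use le in \<open>auto intro: finite_subset[of _ "{..2 * card T}"]\<close>)
qed

section \<open>Covers and matchings of a cycle with whiskers\<close>

lemma cycle_degree:
  fixes E :: "'v::finite set set"
  assumes c: "distinct c" "3 \<le> length c" "cycle_edges c \<subseteq> E" and v: "v \<in> set c"
  shows "2 \<le> Defs.degree E v"
proof -
  let ?m = "length c"
  have m: "0 < ?m" using c by linarith
  from v obtain i where i: "i < ?m" "v = c ! i" by (metis in_set_conv_nth)
  \<comment> \<open>The predecessor and successor positions of \<open>v\<close>; they differ because
    the cycle has length at least 3, which gives two distinct edges at \<open>v\<close>.\<close>
  define p where "p = (if i = 0 then ?m - 1 else i - 1)"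
  define q where "q = Suc i mod ?m"
  have p: "p < ?m" "Suc p mod ?m = i" using i by (auto simp: p_def)
  have q: "q < ?m" using m by (simp add: q_def)
  have pq: "p \<noteq> q" using i c(2) by (auto simp: p_def q_def mod_Suc split: if_splits)
  have pi: "p \<noteq> i" using i c(2) by (auto simp: p_def split: if_splits)
  have "{c ! i, c ! q} \<in> cycle_edges c" "{c ! p, c ! i} \<in> cycle_edges c"
    unfolding cycle_edges_def q_def using i p by auto
  then have "{{c ! i, c ! q}, {c ! p, c ! i}} \<subseteq> {e \<in> E. v \<in> e}" using c(3) i by auto
  then have "card {{c ! i, c ! q}, {c ! p, c ! i}} \<le> Defs.degree E v"
    unfolding degree_def by (intro card_mono) auto
  moreover have "{c ! i, c ! q} \<noteq> {c ! p, c ! i}"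
    using pq pi p q i c(1) by (auto simp: doubleton_eq_iff nth_eq_iff_index_eq)
  ultimately show ?thesis by simp
qed

text \<open>Starting at a vertex with a whisker, a vertex of the cycle goes into the cover iff it carries a
  whisker or its predecessor is not in the cover; it is matched to a whisker end in the first case
  and to its predecessor in the second.\<close>

primrec in_cover :: "(nat \<Rightarrow> bool) \<Rightarrow> nat \<Rightarrow> bool" where
  "in_cover w 0 = True"
| "in_cover w (Suc i) = (w (Suc i) \<or> \<not> in_cover w i)"

lemma cycle_with_whiskers_koenig:
  fixes E :: "'v::finite set set"
  assumes cyc: "cycle_with_whiskers E" and wh: "\<exists>e. whisker E e"
  obtains T \<phi> where "koenig E T \<phi>"
proof -
  from cyc obtain c f where c: "distinct c" "3 \<le> length c"
    and f: "\<And>w. w \<notin> set c \<Longrightarrow> f w \<in> set c"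
    and E: "E = cycle_edges c \<union> {{w, f w} | w. w \<notin> set c}"
    unfolding cycle_with_whiskers_def by blast
  let ?m = "length c"
  have m: "0 < ?m" using c by linarith
  \<comment> \<open>Cycle vertices have degree at least 2, so the vertex of degree 1 on the given
    whisker lies off the cycle.\<close>
  obtain l where l: "l \<notin> set c"
  proof -
    from wh obtain v where "Defs.degree E v = 1" unfolding whisker_def by blast
    then have "v \<notin> set c" using cycle_degree[OF c, of E v] E by auto
    then show ?thesis by (rule that)
  qed
  then obtain j where j: "j < ?m" "c ! j = f l" using f by (metis in_set_conv_nth)
  \<comment> \<open>The cycle is rotated to start at the vertex carrying \<open>l\<close> and read
    periodically, so that successors need no wrap-around.\<close>
  define d where "d i = c ! ((j + i) mod ?m)" for i
  have d_mod: "d (i mod ?m) = d i" for i by (simp add: d_def mod_add_right_eq)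
  have d0: "d 0 = f l" using j by (simp add: d_def)
  have dm: "d ?m = d 0" by (simp add: d_def)
  have d_in: "d i \<in> set c" for i using m by (simp add: d_def)
  have d_shift: "d (i + (?m - j)) = c ! (i mod ?m)" for i
  proof -
    have "j + (i + (?m - j)) = i + ?m" using j by simp
    then show ?thesis by (simp add: d_def)
  qed
  have d_surj: "\<exists>i<?m. v = d i" if "v \<in> set c" for v
  proof -
    from that obtain i where "i < ?m" "v = c ! i" by (metis in_set_conv_nth)
    then have "v = d ((i + (?m - j)) mod ?m)" unfolding d_mod d_shift by simp
    then show ?thesis using mod_less_divisor[OF m] by blast
  qed
  have "d ` {..<?m} = set c" using d_surj d_in by blast
  \<comment> \<open>A map of \<open>{..<?m}\<close> onto a set of the same size is
    injective.\<close>
  then have d_inj: "inj_on d {..<?m}" by (simp add: eq_card_imp_inj_on distinct_card[OF c(1)])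
  have d_edge: "{d i, d (Suc i)} \<in> E" for i
  proof -
    have "{c ! ((j + i) mod ?m), c ! (Suc ((j + i) mod ?m) mod ?m)} \<in> cycle_edges c"
      unfolding cycle_edges_def using m by auto
    then show ?thesis unfolding E d_def by (simp add: mod_Suc_eq)
  qed
  have edge_d: "\<exists>i<?m. e = {d i, d (Suc i)}" if e: "e \<in> cycle_edges c" for e
  proof -
    from e obtain i where i: "i < ?m" "e = {c ! i, c ! (Suc i mod ?m)}"
      unfolding cycle_edges_def by blast
    let ?i = "(i + (?m - j)) mod ?m"
    have "d ?i = c ! i" unfolding d_mod d_shift using i by simp
    moreover have "d (Suc ?i) = c ! (Suc i mod ?m)"
      using d_shift[of "Suc i"] d_mod[of "Suc ?i"] d_mod[of "Suc (i + (?m - j))"]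
      by (simp add: mod_Suc_eq)
    moreover have "?i < ?m" using m by simp
    ultimately show ?thesis using i by metis
  qed
  \<comment> \<open>The cycle vertices that carry a whisker.\<close>
  define W where "W = f ` (- set c)"
  define \<tau> where "\<tau> = in_cover (\<lambda>i. d i \<in> W)"
  define T where "T = {d i | i. i < ?m \<and> \<tau> i}"
  have W_T: "W \<subseteq> T"
  proof
    fix v assume v: "v \<in> W"
    then obtain i where i: "i < ?m" "v = d i" using d_surj f W_def by blast
    then have "\<tau> i" using v unfolding \<tau>_def by (cases i) auto
    with i show "v \<in> T" unfolding T_def by blast
  qed
  have T_iff: "d i \<in> T \<longleftrightarrow> \<tau> i" if "i < ?m" for i
    using inj_onD[OF d_inj] that unfolding T_def by auto
  have T_sub: "T \<subseteq> set c" using d_in by (auto simp: T_def)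
  have cover: "e \<inter> T \<noteq> {}" if "e \<in> E" for e
  proof (cases "e \<in> cycle_edges c")
    case True
    then obtain i where i: "i < ?m" "e = {d i, d (Suc i)}" using edge_d by blast
    have "d i \<in> T \<or> d (Suc i) \<in> T"
    proof (cases "Suc i < ?m")
      case True
      then show ?thesis using T_iff[of i] T_iff[of "Suc i"] i by (auto simp: \<tau>_def)
    next
      case False
      \<comment> \<open>The edge closing the cycle ends in \<open>d 0\<close>, which is always in
        the cover.\<close>
      then have "Suc i = ?m" using i by simp
      then show ?thesis using dm T_iff[of 0] m by (simp add: \<tau>_def)
    qed
    then show ?thesis using i by blast
  next
    case False
    with that obtain w where "w \<notin> set c" "e = {w, f w}" using E by blast
    then show ?thesis using W_T W_def by blast
  qed
  \<comment> \<open>The conditional clause is kept for injectivity: it lets \<open>t\<close> be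
    recovered from its partner, by \<open>f\<close> from a whisker end and as the successor from a
    cycle vertex.\<close>
  have ex: "\<exists>p. p \<notin> T \<and> {t, p} \<in> E \<and>
      (if t \<in> W then p \<notin> set c \<and> f p = t else \<exists>i. Suc i < ?m \<and> p = d i \<and> t = d (Suc i))"
    if t: "t \<in> T" for t
  proof (cases "t \<in> W")
    case True
    then obtain w where w: "w \<notin> set c" "t = f w" unfolding W_def by blast
    then have "{t, w} \<in> E" unfolding E by (auto simp: insert_commute)
    then show ?thesis using w True T_sub by auto
  next
    case False
    from t obtain i where i: "i < ?m" "t = d i" "\<tau> i" unfolding T_def by blast
    \<comment> \<open>This justifies starting \<open>in_cover\<close> with \<open>True\<close>: a
      cover vertex without whisker has positive index, hence a predecessor, and that predecessor is
      outside the cover.\<close>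
    have "d 0 \<in> W" using d0 l unfolding W_def by blast
    with False i(2) obtain i' where i': "i = Suc i'" by (cases i) auto
    with i False have "\<not> \<tau> i'" by (simp add: \<tau>_def)
    then have "d i' \<notin> T" using T_iff[of i'] i i' by simp
    moreover have "{t, d i'} \<in> E" using d_edge[of i'] i i' by (simp add: insert_commute)
    ultimately show ?thesis using False i i' by auto
  qed
  then obtain \<phi> where \<phi>: "\<And>t. t \<in> T \<Longrightarrow> \<phi> t \<notin> T \<and> {t, \<phi> t} \<in> E \<and>
      (if t \<in> W then \<phi> t \<notin> set c \<and> f (\<phi> t) = t
       else \<exists>i. Suc i < ?m \<and> \<phi> t = d i \<and> t = d (Suc i))"
    by metis
  have "inj_on \<phi> T"
  proof (rule inj_onI)
    fix a b assume ab: "a \<in> T" "b \<in> T" "\<phi> a = \<phi> b"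
    show "a = b"
    \<comment> \<open>Whisker ends lie off the cycle and predecessors on it, so equal partners arise
      from the same rule.\<close>
    proof (cases "a \<in> W")
      case True
      then have a: "\<phi> a \<notin> set c" "f (\<phi> a) = a" using \<phi>[OF ab(1)] by simp_all
      have "b \<in> W"
      proof (rule ccontr)
        assume "b \<notin> W"
        then obtain i where "\<phi> b = d i" using \<phi>[OF ab(2)] by auto
        then show False using a ab(3) d_in by simp
      qed
      then have "f (\<phi> b) = b" using \<phi>[OF ab(2)] by simp
      then show ?thesis using a ab(3) by simp
    next
      case False
      then obtain i where i: "Suc i < ?m" "\<phi> a = d i" "a = d (Suc i)" using \<phi>[OF ab(1)] by auto
      then have "\<phi> b \<in> set c" using ab(3) d_in[of i] by simp
      then have "b \<notin> W" using \<phi>[OF ab(2)] by auto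
      then obtain i' where i': "Suc i' < ?m" "\<phi> b = d i'" "b = d (Suc i')"
        using \<phi>[OF ab(2)] by auto
      have "i = i'" using inj_onD[OF d_inj, of i i'] i i' ab(3) by simp
      with i i' show ?thesis by simp
    qed
  qed
  then have "koenig E T \<phi>" unfolding koenig_def using cover \<phi> by simp
  then show ?thesis by (rule that)
qed

section \<open>The limit\<close>

theorem theorem5p11:
  fixes E :: "'v::finite set set"
  assumes "simple_graph E"
    and "cycle_with_whiskers E"
    and "\<exists>e. whisker E e"
  shows "convergent (\<lambda>k. real (v_graph TYPE('k::field) E k) / real k) \<and>
    diagonal_F_threshold TYPE('k) E = 2 * real CARD('v) - real (b_graph E)"
proof -
  obtain T \<phi> where K: "koenig E T \<phi>"
    using assms(2,3) by (rule cycle_with_whiskers_koenig)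
  define L where "L = 2 * real CARD('v) - real (b_graph E)"
  \<comment> \<open>Both \<open>b_graph E = 2 * card T\<close> and the value of
    \<open>v_graph\<close> are expressed through \<open>T\<close>, so \<open>L\<close> is the factor
    of \<open>k - 1\<close> in \<open>v_graph\<close>.\<close>
  have L: "L = real (2 * card (- T))"
    unfolding L_def using b_graph_koenig[OF K] card_mono[of UNIV T]
    by (simp add: Compl_eq_Diff_UNIV card_Diff_subset of_nat_diff)
  have "(\<lambda>k. L - L / real k) \<longlonglongrightarrow> L - 0"
    by (intro tendsto_diff tendsto_const lim_const_over_n)
  moreover have "\<forall>\<^sub>F k in sequentially.
      L - L / real k = real (v_graph TYPE('k) E k) / real k"
    \<comment> \<open>The value \<open>(k - 1) * L\<close> is available for positive
      \<open>k\<close>; at \<open>k = 0\<close> the maximum is unspecified.\<close>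
    using eventually_gt_at_top[of 0]
  proof eventually_elim
    case (elim k)
    then have "real (v_graph TYPE('k) E k) = (real k - 1) * L"
      unfolding L v_graph_koenig[OF K elim] by (simp add: of_nat_diff)
    then show ?case using elim by (simp add: left_diff_distrib diff_divide_distrib)
  qed
  ultimately have "(\<lambda>k. real (v_graph TYPE('k) E k) / real k) \<longlonglongrightarrow> L - 0"
    by (rule Lim_transform_eventually)
  then have lim: "(\<lambda>k. real (v_graph TYPE('k) E k) / real k) \<longlonglongrightarrow> L" by simp
  show ?thesis
    unfolding diagonal_F_threshold_def L_def[symmetric]
    using convergentI[OF lim] limI[OF lim] by (rule conjI)
qed

end
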